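(* Let $\mathcal{T}$ be a single-elimination tournament with $n$ players and let $U\subseteq V(\mathcal{T})$ be the set of vertices $u$ such that there is no $x\in N^+(u)$ with $N^-(x)=\{a,u\}$ for some player $a\in P(\mathcal{T})$. Then for every scoring system $\sigma$ of $\mathcal{T}$, \[\dim(\mathcal{T},\sigma)\le \min_{u\in U}\left( n-|P(u)|+\max\Big\{0,\ \dim(\mathcal{T}_u,\sigma_u)-\sum_{x\in M(\mathcal{T})\setminus M(\mathcal{T}_u)}\Big\lfloor \tfrac{|N^-(x)\cap (P(\mathcal{T})\setminus P(u))|}{2}\Big\rfloor\Big\}\right).\]
   Context: A single-elimination tournament is a finite directed graph $\mathcal{T}$ such that: (a) $\mathcal{T}$ has exactly one sink (vertex with no out-neighbours); (b) every non-sink vertex has exactly one out-neighbour; (c) $\mathcal{T}$ has no directed cycles; (d) $|N^-(v)|\ne 1$ for every vertex $v$, where $N^-(v)$ (resp. $N^+(v)$) denotes the set of in-neighbours (resp. out-neighbours) of $v$. The players $P(\mathcal{T})$ are the sources (vertices with no in-neighbours) and the matches are $M(\mathcal{T})=V(\mathcal{T})\setminus P(\mathcal{T})$. For a vertex $u$, $P(u)$ is the set of players $a$ for which there is a directed walk from $a$ to $u$ (a sequence $(u_1,\dots,u_t)$, $t\ge1$, $u_1=a$, $u_t=u$, $u_{i+1}\in N^+(u_i)$). For $u\in V(\mathcal{T})$, $\mathcal{T}_u$ is the digraph obtained from $\mathcal{T}$ by deleting every vertex $v$ with $P(v)\not\subseteq P(u)$; it is itself a single-elimination tournament, and $\sigma_u$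 is the restriction of $\sigma$ to $M(\mathcal{T})\cap V(\mathcal{T}_u)=M(\mathcal{T}_u)$. A bracket is a function $B:V(\mathcal{T})\to P(\mathcal{T})$ with $B(a)=a$ for every player $a$ and $B(x)\in\{B(u):u\in N^-(x)\}$ for every match $x$. A scoring system is any function $\sigma:M(\mathcal{T})\to\mathbb{R}_{>0}$. For brackets $B,B'$ let $\mathrm{score}_\sigma(B,B')=\sum_{x\in M(\mathcal{T}):\,B(x)=B'(x)}\sigma(x)$. A set of brackets $\mathcal{B}$ is $\sigma$-resolving if for every pair of distinct brackets $B\ne B'$ there is $B_i\in\mathcal{B}$ with $\mathrm{score}_\sigma(B_i,B)\ne\mathrm{score}_\sigma(B_i,B')$. $\dim(\mathcal{T},\sigma)$ denotes the minimum size of a $\sigma$-resolving set (with the same definitions applied to $(\mathcal{T}_u,\sigma_u)$). *)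

theory Defs
  imports Complex_Main
begin

definition outN :: "'v set \<Rightarrow> ('v \<times> 'v) set \<Rightarrow> 'v \<Rightarrow> 'v set" where
  "outN V E v = {w \<in> V. (v, w) \<in> E}"

definition inN :: "'v set \<Rightarrow> ('v \<times> 'v) set \<Rightarrow> 'v \<Rightarrow> 'v set" where
  "inN V E v = {w \<in> V. (w, v) \<in> E}"

definition se_tournament :: "'v set \<Rightarrow> ('v \<times> 'v) set \<Rightarrow> bool" where
  "se_tournament V E \<longleftrightarrow>
     finite V \<and> E \<subseteq> V \<times> V \<and>
     (\<exists>!s. s \<in> V \<and> outN V E s = {}) \<and>
     (\<forall>v\<in>V. outN V E v \<noteq> {} \<longrightarrow> card (outN V E v) = 1) \<and>
     (\<forall>v. (v, v) \<notin> E\<^sup>+) \<and>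
     (\<forall>v\<in>V. card (inN V E v) \<noteq> 1)"

definition players :: "'v set \<Rightarrow> ('v \<times> 'v) set \<Rightarrow> 'v set" where
  "players V E = {v \<in> V. inN V E v = {}}"

definition matches :: "'v set \<Rightarrow> ('v \<times> 'v) set \<Rightarrow> 'v set" where
  "matches V E = V - players V E"

definition playersOf :: "'v set \<Rightarrow> ('v \<times> 'v) set \<Rightarrow> 'v \<Rightarrow> 'v set" where
  "playersOf V E u = {a \<in> players V E. (a, u) \<in> E\<^sup>*}"

definition subV :: "'v set \<Rightarrow> ('v \<times> 'v) set \<Rightarrow> 'v \<Rightarrow> 'v set" where
  "subV V E u = {v \<in> V. playersOf V E v \<subseteq> playersOf V E u}"

definition subE :: "'v set \<Rightarrow> ('v \<times> 'v) set \<Rightarrow> 'v \<Rightarrow> ('v \<times> 'v) set" where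
  "subE V E u = E \<inter> (subV V E u \<times> subV V E u)"

definition brackets :: "'v set \<Rightarrow> ('v \<times> 'v) set \<Rightarrow> ('v \<Rightarrow> 'v) set" where
  "brackets V E = {B. (\<forall>v. v \<notin> V \<longrightarrow> B v = undefined) \<and>
                      (\<forall>a\<in>players V E. B a = a) \<and>
                      (\<forall>x\<in>matches V E. B x \<in> B ` inN V E x)}"

definition scoring_system :: "'v set \<Rightarrow> ('v \<times> 'v) set \<Rightarrow> ('v \<Rightarrow> real) \<Rightarrow> bool" where
  "scoring_system V E \<sigma> \<longleftrightarrow> (\<forall>x\<in>matches V E. \<sigma> x > 0)"

definition score :: "'v set \<Rightarrow> ('v \<times> 'v) set \<Rightarrow> ('v \<Rightarrow> real) \<Rightarrow> ('v \<Rightarrow> 'v) \<Rightarrow> ('v \<Rightarrow> 'v) \<Rightarrow> real" where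
  "score V E \<sigma> B B' = (\<Sum>x\<in>{x \<in> matches V E. B x = B' x}. \<sigma> x)"

definition resolving :: "'v set \<Rightarrow> ('v \<times> 'v) set \<Rightarrow> ('v \<Rightarrow> real) \<Rightarrow> ('v \<Rightarrow> 'v) set \<Rightarrow> bool" where
  "resolving V E \<sigma> R \<longleftrightarrow> R \<subseteq> brackets V E \<and>
     (\<forall>B\<in>brackets V E. \<forall>B'\<in>brackets V E. B \<noteq> B' \<longrightarrow>
        (\<exists>Bi\<in>R. score V E \<sigma> Bi B \<noteq> score V E \<sigma> Bi B'))"

definition tdim :: "'v set \<Rightarrow> ('v \<times> 'v) set \<Rightarrow> ('v \<Rightarrow> real) \<Rightarrow> nat" where
  "tdim V E \<sigma> = (LEAST k. \<exists>R. finite R \<and> card R = k \<and> resolving V E \<sigma> R)"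

end

theory Submission
  imports Defs
begin

text \<open>
  Fix \<open>u\<close> and pair up, at every match outside \<open>T\<^sub>u\<close>, the players outside \<open>P(u)\<close> that enter there; this
  gives \<open>k\<close> pairs, where \<open>k\<close> is the sum of the floors. The condition \<open>u \<in> U\<close> ensures that every match
  outside \<open>T\<^sub>u\<close> has a paired player below it, so there is a default assignment \<open>D\<close> under which
  all these matches are won by paired players. For each outer player \<open>a\<close> take the bracket in which \<open>a\<close>
  wins its whole path, \<open>D\<close> decides the other outer matches, and the part on \<open>T\<^sub>u\<close> is a member of a
  resolving set of \<open>T\<^sub>u\<close>, the same for both members of a pair but otherwise varying with the pair.
  The scores of a pair then differ by the weight of the wins of one partner minus that of the other,
  and at most one of the two weights is nonzero; this determines the wins of all paired players, then
  those of the unpaired ones, and what remains of each score resolves \<open>T\<^sub>u\<close>. Members of the resolving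
  set of \<open>T\<^sub>u\<close> exceeding the number of pairs are completed by \<open>D\<close> and added separately.
\<close>

section \<open>Finite sets: labels in pairs, and maps missing few values\<close>

lemma ex_halving_labels:
  assumes "finite S"
  shows "\<exists>\<psi> :: 'a \<Rightarrow> nat. \<forall>i < card S div 2. \<exists>a\<in>S. \<exists>b\<in>S. a \<noteq> b \<and> \<psi> a = i \<and> \<psi> b = i"
proof -
  obtain h where h: "bij_betw h {0..<card S} S"
    using ex_bij_betw_nat_finite[OF assms] by blast
  let ?j = "the_inv_into {0..<card S} h"
  have j: "?j (h m) = m" if "m < card S" for m
    using h that by (intro the_inv_into_f_f) (auto simp: bij_betw_def)
  \<comment> \<open>The elements numbered \<open>2 * i\<close> and \<open>2 * i + 1\<close> get
    label \<open>i\<close>. If the size is odd, the last element gets a label outside the range and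
    stays single.\<close>
  have "\<exists>a\<in>S. \<exists>b\<in>S. a \<noteq> b \<and> ?j a div 2 = i \<and> ?j b div 2 = i" if "i < card S div 2" for i
  proof (intro bexI conjI)
    have lt: "2 * i < card S" "2 * i + 1 < card S" using that by linarith+
    show "?j (h (2 * i)) div 2 = i" "?j (h (2 * i + 1)) div 2 = i"
      using j lt by simp_all
    show "h (2 * i) \<in> S" "h (2 * i + 1) \<in> S"
      using h lt by (auto simp: bij_betw_def)
    show "h (2 * i) \<noteq> h (2 * i + 1)"
      using j[OF lt(1)] j[OF lt(2)] by auto
  qed
  then show ?thesis by (intro exI[of _ "\<lambda>a. ?j a div 2"]) blast
qed

text \<open>Serves to spread a resolving set \<open>R\<close> of the subtournament over the index
  set \<open>I\<close> of pairs. The map is onto \<open>R\<close> if \<open>I\<close> is large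
  enough and injective otherwise, so the truncated difference counts the missed members in both
  cases.\<close>

lemma ex_map_small_deficit:
  assumes "finite I" "I \<noteq> {}" "finite R" "R \<noteq> {}"
  shows "\<exists>g. g ` I \<subseteq> R \<and> card (R - g ` I) = card R - card I"
proof (cases "card R \<le> card I")
  case True
  then obtain f where f: "inj_on f R" "f ` R \<subseteq> I"
    using card_le_inj[OF assms(3,1)] by auto
  obtain r where r: "r \<in> R" using assms by blast
  let ?g = "\<lambda>i. if i \<in> f ` R then the_inv_into R f i else r"
  have "?g ` I \<subseteq> R" using r the_inv_into_into[OF f(1) _ subset_refl] by auto
  moreover have "x \<in> ?g ` I" if "x \<in> R" for x
  proof (rule image_eqI)
    show "x = ?g (f x)" using that f by (simp add: the_inv_into_f_f)
    show "f x \<in> I" using that f by auto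
  qed
  ultimately have "?g ` I = R" by blast
  then show ?thesis using True by (intro exI[of _ ?g]) auto
next
  case False
  then obtain g where g: "inj_on g I" "g ` I \<subseteq> R"
    using card_le_inj[OF assms(1,3)] by auto
  then show ?thesis
    using assms by (intro exI[of _ g]) (auto simp: card_Diff_subset card_image)
qed

section \<open>Resolving sets and dimension\<close>

lemma tdim_le:
  assumes "finite R" "resolving V E \<sigma> R"
  shows "tdim V E \<sigma> \<le> card R"
  unfolding tdim_def using assms by (intro Least_le) blast

lemma score_eq_sum_if:
  assumes "finite V"
  shows "score V E \<sigma> B B' = (\<Sum>x\<in>matches V E. if B x = B' x then \<sigma> x else 0)"
  unfolding score_def using assms by (intro sum.inter_filter) (simp add: matches_def)

text \<open>A bracket scores strictly more against itself than against any other, as all weights are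
  positive. Since there are finitely many brackets, the \<open>LEAST\<close> in \<open>tdim\<close>
  is attained.\<close>

lemma resolving_brackets:
  assumes "finite V" "scoring_system V E \<sigma>"
  shows "resolving V E \<sigma> (brackets V E)"
  unfolding resolving_def
proof (intro conjI ballI impI subset_refl)
  fix B B' assume B: "B \<in> brackets V E" "B' \<in> brackets V E" "B \<noteq> B'"
  obtain x where x: "B x \<noteq> B' x" using B by blast
  then have xM: "x \<in> matches V E"
    using B unfolding brackets_def matches_def by (cases "x \<in> V"; cases "x \<in> players V E") auto
  have "score V E \<sigma> B B' < score V E \<sigma> B B"
    unfolding score_eq_sum_if[OF assms(1)]
    using assms x xM unfolding scoring_system_def
    by (intro sum_strict_mono_ex1) (auto simp: matches_def intro: less_imp_le)
  then show "\<exists>Bi\<in>brackets V E. score V E \<sigma> Bi B \<noteq> score V E \<sigma> Bi B'"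
    using B by (intro bexI[of _ B]) auto
qed

section \<open>Reachability in a tournament\<close>

locale tournament =
  fixes V :: "'v set" and E :: "('v \<times> 'v) set"
  assumes se_tournament: "se_tournament V E"
begin

lemma finite_V: "finite V" and E_subset: "E \<subseteq> V \<times> V" and acyclic_E: "acyclic E"
  using se_tournament unfolding se_tournament_def acyclic_def by auto

lemma finite_players: "finite (players V E)" and finite_matches: "finite (matches V E)"
  using finite_V unfolding players_def matches_def by auto

lemma out_unique:
  assumes "(v, w) \<in> E" "(v, w') \<in> E"
  shows "w = w'"
proof -
  have "w \<in> outN V E v" "w' \<in> outN V E v" "v \<in> V"
    using assms E_subset unfolding outN_def by auto
  moreover from this have "card (outN V E v) = 1"
    using se_tournament unfolding se_tournament_def by blast
  ultimately show ?thesis by (auto simp: card_1_singleton_iff)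
qed

lemma wf_E: "wf E"
  using finite_subset[OF E_subset] finite_V acyclic_E by (intro finite_acyclic_wf) auto

lemma rtrancl_V_down: "(v, w) \<in> E\<^sup>* \<Longrightarrow> w \<in> V \<Longrightarrow> v \<in> V"
  by (induction rule: rtrancl_induct) (use E_subset in auto)

lemma rtrancl_V_closed: "(v, w) \<in> E\<^sup>* \<Longrightarrow> v \<in> V \<Longrightarrow> w \<in> V"
  by (induction rule: rtrancl_induct) (use E_subset in auto)

lemma reach_from_successor:
  assumes "(x, y) \<in> E" "(x, z) \<in> E\<^sup>*" "x \<noteq> z"
  shows "(y, z) \<in> E\<^sup>*"
  using assms by (metis converse_rtranclE out_unique)

text \<open>Every walk from \<open>a\<close> follows the unique out-neighbours, so the vertices
  above \<open>a\<close> form a chain.\<close>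

lemma reach_chain:
  assumes "(a, x) \<in> E\<^sup>*" "(a, y) \<in> E\<^sup>*"
  shows "(x, y) \<in> E\<^sup>* \<or> (y, x) \<in> E\<^sup>*"
  using assms(1)
proof (induction rule: rtrancl_induct)
  case base then show ?case using assms by blast
next
  case (step x x')
  then show ?case by (metis rtrancl.rtrancl_into_rtrancl rtrancl.rtrancl_refl reach_from_successor)
qed

text \<open>Distinct in-neighbours above a common \<open>a\<close> would be comparable, and the walk
  from one to the other would pass through \<open>x\<close> and close a cycle. Hence the parts below
  different in-neighbours are disjoint.\<close>

lemma sibling_reach_eq:
  assumes "(y, x) \<in> E" "(z, x) \<in> E" "(a, y) \<in> E\<^sup>*" "(a, z) \<in> E\<^sup>*"
  shows "y = z"
proof (rule ccontr)
  assume "y \<noteq> z"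
  then have "(x, y) \<in> E\<^sup>* \<or> (x, z) \<in> E\<^sup>*"
    using reach_chain[OF assms(3,4)] reach_from_successor assms by metis
  then show False
    using assms acyclic_E unfolding acyclic_def by (meson rtrancl_into_trancl1)
qed

lemma player_reached: "a \<in> players V E \<Longrightarrow> (v, a) \<in> E\<^sup>* \<Longrightarrow> v = a"
  using E_subset unfolding players_def inN_def by (auto elim: rtranclE)

lemma ex_player_below:
  assumes "v \<in> V"
  shows "\<exists>a\<in>players V E. (a, v) \<in> E\<^sup>*"
  using wf_E assms
proof (induction v rule: wf_induct_rule)
  case (less v)
  show ?case
  proof (cases "v \<in> players V E")
    case False
    then obtain w where "w \<in> V" "(w, v) \<in> E" using less.prems unfolding players_def inN_def by auto
    then show ?thesis using less.IH by (meson rtrancl.rtrancl_into_rtrancl)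
  qed blast
qed

text \<open>Following out-neighbours must end, by finiteness and acyclicity, in a vertex without
  any, and the sink is the only such vertex.\<close>

lemma ex_root: "\<exists>s\<in>V. \<forall>v\<in>V. (v, s) \<in> E\<^sup>*"
proof -
  have "\<exists>!s. s \<in> V \<and> outN V E s = {}"
    using se_tournament unfolding se_tournament_def by (elim conjE)
  then obtain s where s: "s \<in> V" "\<And>t. t \<in> V \<Longrightarrow> outN V E t = {} \<Longrightarrow> t = s"
    by (elim ex1E) blast
  have wf: "wf (E\<inverse>)"
    using finite_subset[OF E_subset] finite_V acyclic_E by (intro finite_acyclic_wf_converse) auto
  have "v \<in> V \<longrightarrow> (v, s) \<in> E\<^sup>*" for v
    using wf
  proof (induction v rule: wf_induct_rule)
    case (less v)
    show ?case
    proof (cases "outN V E v = {}")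
      case False
      then show ?thesis using less unfolding outN_def by (auto intro: converse_rtrancl_into_rtrancl)
    qed (use s in blast)
  qed
  then show ?thesis using s by blast
qed

lemma two_le_card_inN:
  assumes "x \<in> matches V E"
  shows "2 \<le> card (inN V E x)"
proof -
  have "card (inN V E x) \<noteq> 0" "card (inN V E x) \<noteq> 1"
    using assms se_tournament finite_V
    unfolding matches_def players_def se_tournament_def inN_def by auto
  then show ?thesis by linarith
qed

section \<open>Brackets: winners and existence\<close>

lemma bracket_player_below:
  assumes "B \<in> brackets V E" "v \<in> V"
  shows "B v \<in> players V E \<and> (B v, v) \<in> E\<^sup>*"
  using wf_E assms(2)
proof (induction v rule: wf_induct_rule)
  case (less v)
  show ?case
  proof (cases "v \<in> players V E")
    case True
    then show ?thesis using assms by (auto simp: brackets_def)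
  next
    case False
    then have "B v \<in> B ` inN V E v" using assms less.prems by (auto simp: brackets_def matches_def)
    then obtain w where "w \<in> V" "(w, v) \<in> E" "B v = B w" by (auto simp: inN_def)
    then show ?thesis using less.IH by (metis rtrancl.rtrancl_into_rtrancl)
  qed
qed

text \<open>The winner of \<open>x\<close> comes up through one in-neighbour. As the parts below
  in-neighbours are disjoint, this is the one above \<open>y\<close>, and the argument descends to
  it.\<close>

lemma bracket_winner_below:
  assumes "B \<in> brackets V E" "x \<in> V" "(B x, y) \<in> E\<^sup>*" "(y, x) \<in> E\<^sup>*"
  shows "B y = B x"
  using wf_E assms(2-)
proof (induction x rule: wf_induct_rule)
  case (less x)
  show ?case
  proof (cases "y = x")
    case False
    then obtain z where z: "(y, z) \<in> E\<^sup>*" "(z, x) \<in> E"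
      using less.prems by (metis rtranclE)
    then have zV: "z \<in> V" using E_subset by auto
    then have "x \<in> matches V E"
      using z less.prems by (auto simp: matches_def players_def inN_def)
    then obtain w where w: "w \<in> V" "(w, x) \<in> E" "B x = B w"
      using assms(1) by (auto simp: brackets_def inN_def)
    have "w = z"
      using sibling_reach_eq[OF w(2) z(2)] bracket_player_below[OF assms(1) w(1)] w(3) z(1) less.prems
      by (metis rtrancl_trans)
    then show ?thesis using less.IH[OF z(2) zV] w z less.prems by auto
  qed simp
qed

lemma finite_brackets: "finite (brackets V E)"
proof (rule finite_subset)
  show "brackets V E \<subseteq> {B. \<forall>v. (v \<in> V \<longrightarrow> B v \<in> players V E) \<and> (v \<notin> V \<longrightarrow> B v = undefined)}"
    using bracket_player_below by (auto simp: brackets_def)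
  show "finite {B. \<forall>v. (v \<in> V \<longrightarrow> B v \<in> players V E) \<and> (v \<notin> V \<longrightarrow> B v = undefined)}"
    using finite_V finite_players by (rule finite_set_of_finite_funs)
qed

text \<open>Applied to the paired players it yields the default \<open>D\<close>; applied to all
  players it yields a bracket. The last clause keeps the chosen in-neighbour above
  \<open>D x\<close>, from which it will follow that it lies outside the subtournament.\<close>

lemma ex_favourites:
  assumes "Z \<subseteq> players V E"
  shows "\<exists>D. (\<forall>v. v \<notin> V \<longrightarrow> D v = undefined) \<and> (\<forall>a\<in>players V E. D a = a) \<and>
    (\<forall>x\<in>matches V E. (\<exists>p\<in>Z. (p, x) \<in> E\<^sup>*) \<longrightarrow>
       D x \<in> Z \<and> (D x, x) \<in> E\<^sup>* \<and> (\<exists>y\<in>inN V E x. D y = D x \<and> (D x, y) \<in> E\<^sup>*))"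
proof -
  have finZ: "finite Z" using assms finite_players finite_subset by blast
  obtain r :: "'v \<Rightarrow> nat" where r: "inj_on r Z"
    using finite_imp_inj_to_nat_seg[OF finZ] by blast
  \<comment> \<open>Every vertex is won by the favourite of least rank below it; this avoids recursion along the tree.\<close>
  define best where "best x = (ARG_MIN r p. p \<in> Z \<and> (p, x) \<in> E\<^sup>*)" for x
  have best: "best x \<in> Z \<and> (best x, x) \<in> E\<^sup>*" if "\<exists>p\<in>Z. (p, x) \<in> E\<^sup>*" for x
    using that arg_min_natI[of "\<lambda>p. p \<in> Z \<and> (p, x) \<in> E\<^sup>*"] unfolding best_def by blast
  have best_le: "r (best x) \<le> r p" if "p \<in> Z" "(p, x) \<in> E\<^sup>*" for x p
    using that arg_min_nat_le[of "\<lambda>p. p \<in> Z \<and> (p, x) \<in> E\<^sup>*"] unfolding best_def by blast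
  define D where "D v = (if v \<notin> V then undefined else if v \<in> players V E then v else best v)" for v
  have "D x \<in> Z \<and> (D x, x) \<in> E\<^sup>* \<and> (\<exists>y\<in>inN V E x. D y = D x \<and> (D x, y) \<in> E\<^sup>*)"
    if x: "x \<in> matches V E" and ex: "\<exists>p\<in>Z. (p, x) \<in> E\<^sup>*" for x
  proof -
    have Dx: "D x = best x" using x by (auto simp: D_def matches_def)
    have "best x \<noteq> x" using best[OF ex] assms x by (auto simp: matches_def)
    then obtain y where y: "(best x, y) \<in> E\<^sup>*" "(y, x) \<in> E"
      using best[OF ex] by (metis rtranclE)
    have yV: "y \<in> V" using y E_subset by auto
    have by': "best y \<in> Z \<and> (best y, y) \<in> E\<^sup>*" using best y best[OF ex] by blast
    \<comment> \<open>Each of the two favourites competes at the other vertex, so their ranks agree,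
      and \<open>r\<close> is injective.\<close>
    have "r (best x) \<le> r (best y)" using best_le by' y by (meson rtrancl.rtrancl_into_rtrancl)
    moreover have "r (best y) \<le> r (best x)" using best_le y best[OF ex] by blast
    ultimately have bxy: "best y = best x" using r by' best[OF ex] by (auto dest: inj_onD)
    \<comment> \<open>This covers the case that \<open>y\<close> is a player, since then only
      \<open>y\<close> reaches \<open>y\<close>.\<close>
    have "D y = best y" using yV player_reached[of y "best y"] by' by (auto simp: D_def)
    then show ?thesis using Dx bxy best[OF ex] y yV by (auto simp: inN_def)
  qed
  moreover have "\<forall>v. v \<notin> V \<longrightarrow> D v = undefined" "\<forall>a\<in>players V E. D a = a"
    by (auto simp: D_def players_def)
  ultimately show ?thesis by blast
qed

lemma ex_bracket: "brackets V E \<noteq> {}"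
proof -
  obtain D where D: "\<forall>v. v \<notin> V \<longrightarrow> D v = undefined" "\<forall>a\<in>players V E. D a = a"
    "\<forall>x\<in>matches V E. (\<exists>p\<in>players V E. (p, x) \<in> E\<^sup>*) \<longrightarrow> (\<exists>y\<in>inN V E x. D y = D x)"
    using ex_favourites[OF subset_refl] by blast
  then have "D \<in> brackets V E"
    using ex_player_below unfolding brackets_def matches_def by (fastforce intro: rev_image_eqI)
  then show ?thesis by blast
qed

lemma ex_min_resolving:
  assumes "scoring_system V E \<sigma>"
  shows "\<exists>R. finite R \<and> card R = tdim V E \<sigma> \<and> resolving V E \<sigma> R"
  unfolding tdim_def
  by (rule LeastI[of _ "card (brackets V E)"])
    (use finite_brackets resolving_brackets[OF finite_V assms] in blast)

section \<open>The weight of a player's wins\<close>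

definition wins :: "('v \<Rightarrow> real) \<Rightarrow> ('v \<Rightarrow> 'v) \<Rightarrow> 'v set \<Rightarrow> 'v \<Rightarrow> real" where
  "wins \<sigma> B X a = (\<Sum>x\<in>X. if B x = a then \<sigma> x else 0)"

lemma wins_nonneg_and_pos_iff:
  assumes "scoring_system V E \<sigma>" "X \<subseteq> matches V E"
  shows "0 \<le> wins \<sigma> B X a" "0 < wins \<sigma> B X a \<longleftrightarrow> (\<exists>x\<in>X. B x = a)"
proof -
  have fin: "finite X" using assms finite_matches finite_subset by blast
  have pos: "\<sigma> x > 0" if "x \<in> X" for x using assms that by (auto simp: scoring_system_def)
  show nn: "0 \<le> wins \<sigma> B X a"
    unfolding wins_def by (intro sum_nonneg) (auto intro: less_imp_le pos)
  have "wins \<sigma> B X a = 0 \<longleftrightarrow> (\<forall>x\<in>X. B x \<noteq> a)"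
    unfolding wins_def using fin pos
    by (subst sum_nonneg_eq_0_iff) (auto intro: less_imp_le simp: less_imp_neq[THEN not_sym])
  then show "0 < wins \<sigma> B X a \<longleftrightarrow> (\<exists>x\<in>X. B x = a)" using nn by (auto simp: less_le)
qed

text \<open>The matches won by \<open>a\<close> form an initial segment of its path to the root, so two brackets give
  nested sets of wins, and equal positive weight makes nested sets equal.\<close>

lemma wins_eq_imp:
  assumes "scoring_system V E \<sigma>" "X \<subseteq> matches V E"
    and B: "B \<in> brackets V E" "B' \<in> brackets V E"
    and eq: "wins \<sigma> B X a = wins \<sigma> B' X a" and "x \<in> X"
  shows "B x = a \<longleftrightarrow> B' x = a"
proof (rule ccontr)
  have fin: "finite X" using assms finite_matches finite_subset by blast
  have pos: "\<sigma> x > 0" if "x \<in> X" for x using assms that by (auto simp: scoring_system_def)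
  have XV: "X \<subseteq> V" using assms by (auto simp: matches_def)
  have less: "wins \<sigma> B2 X a < wins \<sigma> B1 X a"
    if B12: "B1 \<in> brackets V E" "B2 \<in> brackets V E" and x: "B1 x = a" "B2 x \<noteq> a" for B1 B2
  proof -
    have imp: "B1 y = a" if y: "y \<in> X" "B2 y = a" for y
    proof -
      have yV: "y \<in> V" and xV: "x \<in> V" using y assms XV by auto
      have ax: "(a, x) \<in> E\<^sup>*" and ay: "(a, y) \<in> E\<^sup>*"
        using bracket_player_below[OF B12(1) xV] bracket_player_below[OF B12(2) yV] x y by auto
      \<comment> \<open>Otherwise the win of \<open>a\<close> at \<open>y\<close> in
        \<open>B2\<close> would entail a win at \<open>x\<close>.\<close>
      have "(x, y) \<notin> E\<^sup>*"
        using bracket_winner_below[OF B12(2) yV, of x] ax x y by auto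
      then have "(y, x) \<in> E\<^sup>*" using reach_chain ax ay by blast
      then show ?thesis using bracket_winner_below[OF B12(1) xV, of y] ay x by auto
    qed
    show ?thesis unfolding wins_def
      using fin imp x \<open>x \<in> X\<close> pos
      by (intro sum_strict_mono_ex1) (auto intro: less_imp_le)
  qed
  assume "(B x = a) \<noteq> (B' x = a)"
  then show False using less B eq by (metis less_irrefl)
qed

end

section \<open>The subtournament at a vertex\<close>

locale tournament_at = tournament V E for V :: "'v set" and E +
  fixes u :: 'v
  assumes u_in_V: "u \<in> V"
begin

abbreviation "S \<equiv> subV V E u"
abbreviation "F \<equiv> subE V E u"

text \<open>If all players below \<open>v\<close> are below \<open>u\<close> but \<open>v\<close> is
  not, then \<open>v\<close> is strictly above \<open>u\<close>. By condition (d) it has an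
  in-neighbour other than the one above \<open>u\<close>, and a player below that one would also be
  below \<open>u\<close>, against disjointness.\<close>

lemma subV_iff: "v \<in> S \<longleftrightarrow> (v, u) \<in> E\<^sup>*"
proof
  assume "(v, u) \<in> E\<^sup>*"
  then show "v \<in> S"
    using rtrancl_V_down u_in_V unfolding subV_def playersOf_def by (auto intro: rtrancl_trans)
next
  assume v: "v \<in> S"
  then have vV: "v \<in> V" and sub: "\<And>a. a \<in> players V E \<Longrightarrow> (a, v) \<in> E\<^sup>* \<Longrightarrow> (a, u) \<in> E\<^sup>*"
    by (auto simp: subV_def playersOf_def)
  show "(v, u) \<in> E\<^sup>*"
  proof (rule ccontr)
    assume n: "(v, u) \<notin> E\<^sup>*"
    obtain a where "a \<in> players V E" "(a, v) \<in> E\<^sup>*" using ex_player_below vV by blast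
    then have uv: "(u, v) \<in> E\<^sup>*" using sub reach_chain n by blast
    moreover have "u \<noteq> v" using n by blast
    ultimately obtain y where y: "(u, y) \<in> E\<^sup>*" "(y, v) \<in> E" by (metis rtranclE)
    then have "v \<in> matches V E" using E_subset by (auto simp: matches_def players_def inN_def)
    then have "2 \<le> card (inN V E v)" by (rule two_le_card_inN)
    then have "\<not> inN V E v \<subseteq> {y}"
      using card_mono[of "{y}" "inN V E v"] by auto
    then obtain z where z: "z \<in> V" "(z, v) \<in> E" "z \<noteq> y" by (auto simp: inN_def)
    obtain b where b: "b \<in> players V E" "(b, z) \<in> E\<^sup>*" using ex_player_below z by blast
    then have "(b, u) \<in> E\<^sup>*" using sub z by (meson rtrancl.rtrancl_into_rtrancl)
    then show False using sibling_reach_eq y z b by (meson rtrancl_trans)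
  qed
qed

lemma subV_subset: "S \<subseteq> V" by (auto simp: subV_def)

lemma subV_down: "(v, w) \<in> E \<Longrightarrow> w \<in> S \<Longrightarrow> v \<in> S"
  unfolding subV_iff by (rule converse_rtrancl_into_rtrancl)

lemma inN_sub: "v \<in> S \<Longrightarrow> inN S F v = inN V E v"
  using subV_down subV_subset unfolding inN_def subE_def by auto

text \<open>A walk of positive length from \<open>v\<close> to \<open>u\<close> would start with the
  edge to \<open>x\<close>. So the subtournament is left only through \<open>u\<close>.\<close>

lemma outside_parent: "v \<in> S \<Longrightarrow> (v, x) \<in> E \<Longrightarrow> x \<notin> S \<Longrightarrow> v = u"
  using reach_from_successor unfolding subV_iff by blast

lemma players_sub: "players S F = players V E \<inter> S"
  using inN_sub subV_subset unfolding players_def by auto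

lemma matches_sub: "matches S F = matches V E \<inter> S"
  using players_sub subV_subset unfolding matches_def by auto

lemma matches_outside: "matches V E - matches S F = matches V E - S"
  unfolding matches_sub by auto

lemma playersOf_eq: "playersOf V E u = players V E \<inter> S"
  by (auto simp: playersOf_def subV_iff)

lemma sub_tournament: "se_tournament S F"
proof -
  have uS: "u \<in> S" by (simp add: subV_iff)
  have out: "outN S F v = outN V E v" if v: "v \<in> S" "v \<noteq> u" for v
    using v outside_parent subV_subset unfolding outN_def subE_def by auto
  \<comment> \<open>An out-neighbour of \<open>u\<close> inside \<open>S\<close> would reach
    \<open>u\<close> again and close a cycle; so \<open>u\<close> is the new sink.\<close>
  have outu: "outN S F u = {}"
    using acyclic_E unfolding outN_def subE_def subV_iff acyclic_def
    by (auto dest: rtrancl_into_trancl2)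
  have outne: "outN V E v \<noteq> {}" if v: "v \<in> S" "v \<noteq> u" for v
  proof -
    obtain w where "(v, w) \<in> E" using v unfolding subV_iff by (metis converse_rtranclE)
    then show ?thesis using E_subset by (auto simp: outN_def)
  qed
  show ?thesis unfolding se_tournament_def
  proof (intro conjI)
    show "finite S" using finite_V subV_subset finite_subset by blast
    show "F \<subseteq> S \<times> S" by (auto simp: subE_def)
    show "\<exists>!s. s \<in> S \<and> outN S F s = {}"
      using uS outu out outne by metis
    show "\<forall>v\<in>S. outN S F v \<noteq> {} \<longrightarrow> card (outN S F v) = 1"
      using out outu subV_subset se_tournament unfolding se_tournament_def by (metis subsetD)
    have "acyclic F" using acyclic_E by (rule acyclic_subset) (auto simp: subE_def)
    then show "\<forall>v. (v, v) \<notin> F\<^sup>+" by (simp add: acyclic_def)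
    show "\<forall>v\<in>S. card (inN S F v) \<noteq> 1"
      using inN_sub subV_subset se_tournament unfolding se_tournament_def by auto
  qed
qed

sublocale sub: tournament S F
  by unfold_locales (rule sub_tournament)

section \<open>Gluing and restricting brackets\<close>

definition glue :: "('v \<Rightarrow> 'v) \<Rightarrow> ('v \<Rightarrow> 'v) \<Rightarrow> 'v \<Rightarrow> 'v" where
  "glue f R v = (if v \<in> S then R v else f v)"

text \<open>The value \<open>undefined\<close> off \<open>S\<close> is what
  \<open>brackets S F\<close> demands of its members.\<close>

definition inner :: "('v \<Rightarrow> 'v) \<Rightarrow> 'v \<Rightarrow> 'v" where
  "inner B v = (if v \<in> S then B v else undefined)"

definition outer_score :: "('v \<Rightarrow> real) \<Rightarrow> ('v \<Rightarrow> 'v) \<Rightarrow> ('v \<Rightarrow> 'v) \<Rightarrow> real" where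
  "outer_score \<sigma> f B = (\<Sum>x\<in>matches V E - S. if f x = B x then \<sigma> x else 0)"

lemma inner_bracket:
  assumes "B \<in> brackets V E"
  shows "inner B \<in> brackets S F"
proof -
  have "inner B x \<in> inner B ` inN S F x" if x: "x \<in> matches S F" for x
  proof -
    have xS: "x \<in> S" "x \<in> matches V E" using x matches_sub by auto
    then have "B x \<in> B ` inN V E x" using assms by (auto simp: brackets_def)
    moreover have "inN V E x \<subseteq> S" using xS subV_down by (auto simp: inN_def)
    ultimately show ?thesis using xS inN_sub by (auto simp: inner_def image_iff)
  qed
  then show ?thesis
    using assms players_sub unfolding brackets_def by (auto simp: inner_def)
qed

text \<open>In the last hypothesis the in-neighbour must avoid \<open>S\<close>, because on
  \<open>S\<close> the glued function takes its values from \<open>R\<close> and not from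
  \<open>f\<close>.\<close>

lemma glue_bracket:
  assumes R: "R \<in> brackets S F"
    and f: "\<And>v. v \<notin> V \<Longrightarrow> f v = undefined" "\<And>a. a \<in> players V E \<Longrightarrow> f a = a"
      "\<And>x. x \<in> matches V E - S \<Longrightarrow> \<exists>y\<in>inN V E x - S. f y = f x"
  shows "glue f R \<in> brackets V E"
proof -
  have "glue f R x \<in> glue f R ` inN V E x" if x: "x \<in> matches V E" for x
  proof (cases "x \<in> S")
    case True
    then have "R x \<in> R ` inN S F x" using R x matches_sub by (auto simp: brackets_def)
    moreover have "inN V E x \<subseteq> S" using True subV_down by (auto simp: inN_def)
    ultimately show ?thesis using True inN_sub by (auto simp: glue_def image_iff)
  next
    case False
    then obtain y where "y \<in> inN V E x - S" "f y = f x" using f(3) x by blast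
    then show ?thesis using False by (auto simp: glue_def intro!: image_eqI[of _ _ y])
  qed
  then show ?thesis
    using R f(1,2) players_sub subV_subset unfolding brackets_def by (auto simp: glue_def)
qed

lemma score_glue:
  "score V E \<sigma> (glue f R) B = score S F \<sigma> R (inner B) + outer_score \<sigma> f B"
proof -
  have "matches V E = matches S F \<union> (matches V E - S)" using matches_sub by auto
  then have "score V E \<sigma> (glue f R) B =
    (\<Sum>x\<in>matches S F \<union> (matches V E - S). if glue f R x = B x then \<sigma> x else 0)"
    using score_eq_sum_if[OF finite_V] by metis
  also have "\<dots> = (\<Sum>x\<in>matches S F. if glue f R x = B x then \<sigma> x else 0) +
      (\<Sum>x\<in>matches V E - S. if glue f R x = B x then \<sigma> x else 0)"
    using finite_matches sub.finite_matches matches_sub by (intro sum.union_disjoint) auto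
  also have "(\<Sum>x\<in>matches S F. if glue f R x = B x then \<sigma> x else 0) = score S F \<sigma> R (inner B)"
    unfolding score_eq_sum_if[OF sub.finite_V] using matches_sub
    by (intro sum.cong) (auto simp: glue_def inner_def)
  also have "(\<Sum>x\<in>matches V E - S. if glue f R x = B x then \<sigma> x else 0) = outer_score \<sigma> f B"
    unfolding outer_score_def by (intro sum.cong) (auto simp: glue_def)
  finally show ?thesis .
qed

section \<open>Champions and pairs of outer players\<close>

abbreviation "outer_players \<equiv> players V E - S"
abbreviation "outer_matches \<equiv> matches V E - S"

definition champion :: "('v \<Rightarrow> 'v) \<Rightarrow> 'v \<Rightarrow> 'v \<Rightarrow> 'v" where
  "champion D a v = (if (a, v) \<in> E\<^sup>* then a else D v)"

text \<open>A class of \<open>\<phi>\<close> may hold more than two players, even ones entering at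
  other matches. No partner is fixed: any sibling in the same class can serve.\<close>

definition paired :: "('v \<Rightarrow> 'i) \<Rightarrow> 'v set" where
  "paired \<phi> = {a \<in> outer_players. \<exists>b\<in>outer_players. \<exists>x. a \<noteq> b \<and> (a, x) \<in> E \<and> (b, x) \<in> E \<and> \<phi> a = \<phi> b}"

text \<open>A label consists of a match and a local number, so labels used at different matches
  cannot clash.\<close>

lemma ex_pairing:
  "\<exists>\<phi> :: 'v \<Rightarrow> 'v \<times> nat. \<forall>x\<in>outer_matches. \<forall>i < card (inN V E x \<inter> outer_players) div 2.
     \<exists>a\<in>outer_players. \<exists>b\<in>outer_players. a \<noteq> b \<and> (a, x) \<in> E \<and> (b, x) \<in> E \<and> \<phi> a = (x, i) \<and> \<phi> b = (x, i)"
proof -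
  have "\<exists>\<psi> :: 'v \<Rightarrow> nat. \<forall>i < card (inN V E x \<inter> outer_players) div 2.
      \<exists>a\<in>inN V E x \<inter> outer_players. \<exists>b\<in>inN V E x \<inter> outer_players. a \<noteq> b \<and> \<psi> a = i \<and> \<psi> b = i" for x
    using finite_players by (intro ex_halving_labels) blast
  then obtain \<psi> :: "'v \<Rightarrow> 'v \<Rightarrow> nat" where
    \<psi>: "\<And>x i. i < card (inN V E x \<inter> outer_players) div 2 \<Longrightarrow>
      \<exists>a\<in>inN V E x \<inter> outer_players. \<exists>b\<in>inN V E x \<inter> outer_players. a \<noteq> b \<and> \<psi> x a = i \<and> \<psi> x b = i"
    by metis
  define \<phi> where "\<phi> a = (let x = THE x. (a, x) \<in> E in (x, \<psi> x a))" for a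
  have \<phi>: "\<phi> a = (x, \<psi> x a)" if "(a, x) \<in> E" for a x
  proof -
    have "(THE x. (a, x) \<in> E) = x" using that out_unique by blast
    then show ?thesis by (simp add: \<phi>_def)
  qed
  show ?thesis
  proof (intro exI[of _ \<phi>] ballI allI impI)
    fix x i assume "i < card (inN V E x \<inter> outer_players) div 2"
    from \<psi>[OF this] obtain a b where "a \<in> inN V E x \<inter> outer_players" "b \<in> inN V E x \<inter> outer_players"
      "a \<noteq> b" "\<psi> x a = i" "\<psi> x b = i" by blast
    then show "\<exists>a\<in>outer_players. \<exists>b\<in>outer_players. a \<noteq> b \<and> (a, x) \<in> E \<and> (b, x) \<in> E \<and> \<phi> a = (x, i) \<and> \<phi> b = (x, i)"
      using \<phi> by (intro bexI[of _ a] bexI[of _ b]) (auto simp: inN_def)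
  qed
qed

text \<open>Descend to a lowest outer match. Its in-neighbours are outer players, except possibly
  \<open>u\<close>; if \<open>u\<close> occurs, the hypothesis \<open>U\<close> rules out that a
  single player accompanies it.\<close>

lemma ex_pair_below:
  assumes U: "\<not> (\<exists>x\<in>outN V E u. \<exists>a\<in>players V E. inN V E x = {a, u})"
    and "x \<in> outer_matches"
  shows "\<exists>y\<in>outer_matches. (y, x) \<in> E\<^sup>* \<and> 2 \<le> card (inN V E y \<inter> outer_players)"
  using wf_E assms(2)
proof (induction x rule: wf_induct_rule)
  case (less x)
  show ?case
  proof (cases "\<exists>y\<in>outer_matches. (y, x) \<in> E")
    case True
    then show ?thesis using less.IH by (meson rtrancl.rtrancl_into_rtrancl)
  next
    case False
    let ?N = "inN V E x \<inter> outer_players"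
    have fin: "finite ?N" using finite_players by blast
    have two: "2 \<le> card (inN V E x)" using less.prems two_le_card_inN by blast
    have sub: "inN V E x \<subseteq> insert u ?N"
      using False less.prems outside_parent by (auto simp: inN_def matches_def)
    have "2 \<le> card ?N"
    proof (cases "u \<in> inN V E x")
      case False
      then have "inN V E x = ?N" using sub by blast
      then show ?thesis using two by simp
    next
      case True
      have uN: "u \<notin> ?N" by (simp add: subV_iff)
      have eq: "inN V E x = insert u ?N" using True sub by blast
      have ux: "x \<in> outN V E u" using True less.prems by (auto simp: inN_def outN_def matches_def)
      have "card ?N \<noteq> 1"
      proof
        assume "card ?N = 1"
        then obtain a where "?N = {a}" by (auto simp: card_1_singleton_iff)
        then show False using U ux eq by auto
      qed
      moreover have "card (inN V E x) = Suc (card ?N)"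
        using card_insert_disjoint[OF fin uN] eq by metis
      ultimately show ?thesis using two by linarith
    qed
    then show ?thesis using less.prems by blast
  qed
qed

lemma sibling_reach_iff:
  assumes "(a, x) \<in> E" "(b, x) \<in> E" "y \<noteq> a" "y \<noteq> b"
  shows "(a, y) \<in> E\<^sup>* \<longleftrightarrow> (b, y) \<in> E\<^sup>*"
  using assms reach_from_successor[of a x y] reach_from_successor[of b x y] by (auto intro: converse_rtrancl_into_rtrancl)

text \<open>Siblings reach the same outer matches. Off this common path both brackets follow
  \<open>D\<close>, which cancels; on it they name \<open>a\<close> and \<open>b\<close>
  throughout.\<close>

lemma outer_score_siblings:
  assumes B: "B \<in> brackets V E"
    and ab: "a \<in> outer_players" "b \<in> outer_players" "(a, x) \<in> E" "(b, x) \<in> E"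
  shows "outer_score \<sigma> (champion D a) B - outer_score \<sigma> (champion D b) B =
    wins \<sigma> B outer_matches a - wins \<sigma> B outer_matches b"
  unfolding outer_score_def wins_def sum_subtractf[symmetric]
proof (intro sum.cong refl)
  fix y assume y: "y \<in> outer_matches"
  then have ne: "y \<noteq> a" "y \<noteq> b" and yV: "y \<in> V" using ab by (auto simp: matches_def)
  have "(a, y) \<notin> E\<^sup>* \<Longrightarrow> B y \<noteq> a" "(b, y) \<notin> E\<^sup>* \<Longrightarrow> B y \<noteq> b"
    using bracket_player_below[OF B yV] by auto
  then show "(if champion D a y = B y then \<sigma> y else 0) - (if champion D b y = B y then \<sigma> y else 0) =
      (if B y = a then \<sigma> y else 0) - (if B y = b then \<sigma> y else 0)"
    using sibling_reach_iff[OF ab(3,4) ne]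
    by (cases "(a, y) \<in> E\<^sup>*") (simp_all add: champion_def eq_commute)
qed

text \<open>Any outer win of \<open>a\<close> or of \<open>b\<close> requires winning the shared
  match \<open>x\<close> first.\<close>

lemma wins_siblings:
  assumes \<sigma>: "scoring_system V E \<sigma>" and B: "B \<in> brackets V E"
    and ab: "a \<noteq> b" "a \<in> outer_players" "b \<in> outer_players" "(a, x) \<in> E" "(b, x) \<in> E"
  shows "wins \<sigma> B outer_matches a = 0 \<or> wins \<sigma> B outer_matches b = 0"
proof (rule ccontr)
  assume "\<not> ?thesis"
  then have "0 < wins \<sigma> B outer_matches a" "0 < wins \<sigma> B outer_matches b"
    using wins_nonneg_and_pos_iff(1)[OF \<sigma> Diff_subset] by (auto simp: less_le)
  then obtain y z where yz: "y \<in> outer_matches" "B y = a" "z \<in> outer_matches" "B z = b"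
    unfolding wins_nonneg_and_pos_iff(2)[OF \<sigma> Diff_subset] by auto
  have *: "B x = c" if c: "c \<in> outer_players" "(c, x) \<in> E" "w \<in> outer_matches" "B w = c" for c w
  proof -
    have wV: "w \<in> V" and "c \<noteq> w" using c by (auto simp: matches_def)
    then have "(x, w) \<in> E\<^sup>*" using bracket_player_below[OF B wV] c reach_from_successor by blast
    then show ?thesis using bracket_winner_below[OF B wV, of x] c by auto
  qed
  show False using *[of a y] *[of b z] ab yz by auto
qed

text \<open>Only whether \<open>f x\<close> wins matters, so it is enough to know the wins of the
  players that \<open>f\<close> names.\<close>

lemma outer_score_cong:
  assumes "\<And>x. x \<in> outer_matches \<Longrightarrow> B x = f x \<longleftrightarrow> B' x = f x"
  shows "outer_score \<sigma> f B = outer_score \<sigma> f B'"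
  unfolding outer_score_def
proof (intro sum.cong refl)
  fix x assume "x \<in> outer_matches"
  then show "(if f x = B x then \<sigma> x else 0) = (if f x = B' x then \<sigma> x else 0)"
    using assms[of x] by (auto simp: eq_commute[of "f x"])
qed

text \<open>A match won by \<open>a\<close> automatically lies on its path, so \<open>wins\<close>
  is the contribution of the path and the sum that of the matches left to \<open>D\<close>.\<close>

lemma outer_score_champion:
  assumes B: "B \<in> brackets V E"
  shows "outer_score \<sigma> (champion D a) B = wins \<sigma> B outer_matches a +
    (\<Sum>x\<in>outer_matches. if (a, x) \<notin> E\<^sup>* \<and> B x = D x then \<sigma> x else 0)"
  unfolding outer_score_def wins_def sum.distrib[symmetric]
proof (intro sum.cong refl)
  fix x assume "x \<in> outer_matches"
  then have "(B x, x) \<in> E\<^sup>*" using bracket_player_below[OF B] by (auto simp: matches_def)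
  then show "(if champion D a x = B x then \<sigma> x else 0) =
      (if B x = a then \<sigma> x else 0) + (if (a, x) \<notin> E\<^sup>* \<and> B x = D x then \<sigma> x else 0)"
    by (auto simp: champion_def)
qed

text \<open>Only differences of outer scores within a class of \<open>\<phi>\<close> are visible. For paired siblings the
  difference of outer scores is the difference of their wins, one of which vanishes.\<close>

lemma paired_wins_determined:
  assumes \<sigma>: "scoring_system V E \<sigma>" and B: "B \<in> brackets V E" "B' \<in> brackets V E"
    and eq: "\<And>a. a \<in> outer_players \<Longrightarrow>
      outer_score \<sigma> (champion D a) B - outer_score \<sigma> (champion D a) B' = c (\<phi> a)"
    and "a \<in> paired \<phi>" "x \<in> outer_matches"
  shows "B x = a \<longleftrightarrow> B' x = a"
proof -
  let ?w = "\<lambda>B. wins \<sigma> B outer_matches"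
  obtain b y where b: "a \<noteq> b" "a \<in> outer_players" "b \<in> outer_players" "(a, y) \<in> E" "(b, y) \<in> E" "\<phi> a = \<phi> b"
    using assms(5) by (auto simp: paired_def)
  have "?w B a - ?w B b = ?w B' a - ?w B' b"
    using outer_score_siblings[OF B(1) b(2-5), of \<sigma> D] outer_score_siblings[OF B(2) b(2-5), of \<sigma> D]
      eq[OF b(2)] eq[OF b(3)] b(6) by simp
  moreover have "0 \<le> ?w B a" "0 \<le> ?w B b" "0 \<le> ?w B' a" "0 \<le> ?w B' b"
    using wins_nonneg_and_pos_iff(1)[OF \<sigma> Diff_subset] by auto
  \<comment> \<open>In each bracket one of the two nonnegative weights is zero, so they are the
    positive and negative parts of their difference.\<close>
  ultimately have "?w B a = ?w B' a"
    using wins_siblings[OF \<sigma> B(1) b(1-5)] wins_siblings[OF \<sigma> B(2) b(1-5)] by linarith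
  then show ?thesis using wins_eq_imp[OF \<sigma> Diff_subset B] assms(6) by blast
qed

text \<open>The unknown \<open>c\<close> stands for the inner scores, which depend on the label
  alone. A paired player with the label of \<open>a\<close> shows that \<open>c\<close> vanishes
  there; then the wins of \<open>a\<close> are what remains of its outer score.\<close>

lemma outer_determined:
  assumes \<sigma>: "scoring_system V E \<sigma>" and B: "B \<in> brackets V E" "B' \<in> brackets V E"
    and D: "\<And>x. x \<in> outer_matches \<Longrightarrow> D x \<in> paired \<phi>"
    and cover: "\<And>a. a \<in> outer_players \<Longrightarrow> \<phi> a \<in> \<phi> ` paired \<phi>"
    and eq: "\<And>a. a \<in> outer_players \<Longrightarrow>
      outer_score \<sigma> (champion D a) B - outer_score \<sigma> (champion D a) B' = c (\<phi> a)"
    and a: "a \<in> outer_players" and x: "x \<in> outer_matches"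
  shows "B x = a \<longleftrightarrow> B' x = a"
proof -
  have pd: "B y = b \<longleftrightarrow> B' y = b" if "b \<in> paired \<phi>" "y \<in> outer_matches" for b y
    by (rule paired_wins_determined[where D = D and c = c and \<phi> = \<phi>, OF \<sigma> B eq that])
  obtain z where z: "z \<in> paired \<phi>" "\<phi> z = \<phi> a" using cover[OF a] by auto
  \<comment> \<open>On outer matches the bracket of \<open>z\<close> names only paired players,
    whose wins are already determined.\<close>
  have "outer_score \<sigma> (champion D z) B = outer_score \<sigma> (champion D z) B'"
    by (intro outer_score_cong pd) (use D z in \<open>auto simp: champion_def\<close>)
  moreover have "z \<in> outer_players" using z by (auto simp: paired_def)
  ultimately have "outer_score \<sigma> (champion D a) B = outer_score \<sigma> (champion D a) B'"
    using eq[OF a] eq[of z] z by simp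
  moreover have "(\<Sum>x\<in>outer_matches. if (a, x) \<notin> E\<^sup>* \<and> B x = D x then \<sigma> x else 0) =
      (\<Sum>x\<in>outer_matches. if (a, x) \<notin> E\<^sup>* \<and> B' x = D x then \<sigma> x else 0)"
    by (intro sum.cong refl) (use pd D in auto)
  ultimately have "wins \<sigma> B outer_matches a = wins \<sigma> B' outer_matches a"
    unfolding outer_score_champion[OF B(1)] outer_score_champion[OF B(2)] by simp
  then show ?thesis using wins_eq_imp[OF \<sigma> Diff_subset B] x by blast
qed

text \<open>A player of the subtournament that wins an outer match must be the winner of
  \<open>u\<close>, and this winner is part of \<open>inner\<close>.\<close>

lemma bracket_eqI:
  assumes B: "B \<in> brackets V E" "B' \<in> brackets V E"
    and inner: "inner B = inner B'"
    and outer: "\<And>a x. a \<in> outer_players \<Longrightarrow> x \<in> outer_matches \<Longrightarrow> B x = a \<longleftrightarrow> B' x = a"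
  shows "B = B'"
proof
  fix v
  have innerS: "B w = B' w" if "w \<in> S" for w
    using fun_cong[OF inner, of w] that by (simp add: inner_def)
  show "B v = B' v"
  proof (cases "v \<in> outer_matches")
    case False
    then show ?thesis using innerS B by (cases "v \<in> V") (auto simp: brackets_def matches_def)
  next
    case True
    then have vV: "v \<in> V" by (auto simp: matches_def)
    have top: "C v = C u" if C: "C \<in> brackets V E" "C v \<in> S" for C
    proof -
      have Cv: "(C v, v) \<in> E\<^sup>*" using bracket_player_below[OF C(1) vV] by blast
      have Cu: "(C v, u) \<in> E\<^sup>*" using C(2) by (simp add: subV_iff)
      have "(u, v) \<in> E\<^sup>*" using reach_chain[OF Cv Cu] True by (auto simp: subV_iff)
      then show ?thesis using bracket_winner_below[OF C(1) vV Cu] by simp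
    qed
    have "u \<in> S" by (simp add: subV_iff)
    then have "B u = B' u" by (rule innerS)
    moreover have "B v \<in> players V E" "B' v \<in> players V E"
      using bracket_player_below B vV by blast+
    ultimately show ?thesis using outer[OF _ True] top B by (metis DiffI)
  qed
qed

section \<open>The bound for a fixed vertex\<close>

lemma tdim_le_at:
  assumes U: "\<not> (\<exists>x\<in>outN V E u. \<exists>a\<in>players V E. inN V E x = {a, u})"
    and \<sigma>: "scoring_system V E \<sigma>" and Q: "outer_players \<noteq> {}"
  shows "tdim V E \<sigma> \<le> card outer_players +
    (tdim S F \<sigma> - (\<Sum>x\<in>outer_matches. card (inN V E x \<inter> outer_players) div 2))"
proof -
  \<comment> \<open>One index for each pair, so that \<open>card I\<close> is the sum of the
    floors.\<close>
  define I where "I = Sigma outer_matches (\<lambda>x. {..<card (inN V E x \<inter> outer_players) div 2})"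
  have finI: "finite I" unfolding I_def using finite_matches by auto
  have cardI: "card I = (\<Sum>x\<in>outer_matches. card (inN V E x \<inter> outer_players) div 2)"
    unfolding I_def using finite_matches by (subst card_SigmaI) auto
  \<comment> \<open>The root is an outer match: were it in the subtournament, every player would
    be.\<close>
  have "outer_matches \<noteq> {}"
  proof -
    obtain a where a: "a \<in> outer_players" using Q by blast
    obtain s where s: "s \<in> V" "\<forall>v\<in>V. (v, s) \<in> E\<^sup>*" using ex_root by blast
    have "a \<in> V" using a by (auto simp: players_def)
    then have as: "(a, s) \<in> E\<^sup>*" and us: "(u, s) \<in> E\<^sup>*" using s u_in_V by auto
    have "(s, u) \<notin> E\<^sup>*" using as a by (auto simp: subV_iff dest: rtrancl_trans)
    moreover have "s \<notin> players V E"
      using us player_reached[of s u] calculation by auto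
    ultimately show ?thesis using s by (auto simp: subV_iff matches_def)
  qed
  then obtain x0 where x0: "x0 \<in> outer_matches" "2 \<le> card (inN V E x0 \<inter> outer_players)"
    using ex_pair_below[OF U] by blast
  then have i0: "(x0, 0) \<in> I" by (auto simp: I_def)
  obtain \<phi>0 :: "'v \<Rightarrow> 'v \<times> nat" where \<phi>0: "\<And>x i. (x, i) \<in> I \<Longrightarrow>
     \<exists>a\<in>outer_players. \<exists>b\<in>outer_players. a \<noteq> b \<and> (a, x) \<in> E \<and> (b, x) \<in> E \<and> \<phi>0 a = (x, i) \<and> \<phi>0 b = (x, i)"
  proof -
    obtain \<phi>0 :: "'v \<Rightarrow> 'v \<times> nat" where
      "\<forall>x\<in>outer_matches. \<forall>i < card (inN V E x \<inter> outer_players) div 2.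
        \<exists>a\<in>outer_players. \<exists>b\<in>outer_players. a \<noteq> b \<and> (a, x) \<in> E \<and> (b, x) \<in> E \<and> \<phi>0 a = (x, i) \<and> \<phi>0 b = (x, i)"
      using ex_pairing by (rule exE)
    then show thesis by (intro that[of \<phi>0]) (simp only: I_def mem_Sigma_iff lessThan_iff)
  qed
  \<comment> \<open>Labels outside \<open>I\<close> are redirected to \<open>(x0, 0)\<close>, so
    that every outer player shares its label with a paired one.\<close>
  define \<phi> where "\<phi> a = (if \<phi>0 a \<in> I then \<phi>0 a else (x0, 0))" for a
  have \<phi>I: "\<phi> a \<in> I" for a using i0 by (auto simp: \<phi>_def)
  have pair: "\<exists>a\<in>paired \<phi>. (a, x) \<in> E \<and> \<phi> a = (x, i)" if xi: "(x, i) \<in> I" for x i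
  proof -
    obtain a b where "a \<in> outer_players" "b \<in> outer_players" "a \<noteq> b" "(a, x) \<in> E" "(b, x) \<in> E"
      "\<phi>0 a = (x, i)" "\<phi>0 b = (x, i)" using \<phi>0[OF xi] by blast
    moreover from this have "\<phi> a = (x, i)" "\<phi> b = (x, i)" using xi by (auto simp: \<phi>_def)
    ultimately have "a \<in> paired \<phi>" "(a, x) \<in> E" "\<phi> a = (x, i)"
      unfolding paired_def mem_Collect_eq by metis+
    then show ?thesis by blast
  qed
  have cover: "\<phi> a \<in> \<phi> ` paired \<phi>" for a
    using pair[of "fst (\<phi> a)" "snd (\<phi> a)"] \<phi>I[of a] by (auto simp: image_iff) metis
  have below: "\<exists>p\<in>paired \<phi>. (p, x) \<in> E\<^sup>*" if x: "x \<in> outer_matches" for x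
  proof -
    obtain y where y: "y \<in> outer_matches" "(y, x) \<in> E\<^sup>*" "2 \<le> card (inN V E y \<inter> outer_players)"
      using ex_pair_below[OF U x] by blast
    then have "(y, 0) \<in> I" by (auto simp: I_def)
    then show ?thesis using pair y by (meson converse_rtrancl_into_rtrancl)
  qed
  have Zsub: "paired \<phi> \<subseteq> outer_players" by (auto simp: paired_def)
  have "paired \<phi> \<subseteq> players V E" using Zsub by blast
  from ex_favourites[OF this] below obtain D where
    D: "\<And>v. v \<notin> V \<Longrightarrow> D v = undefined" "\<And>a. a \<in> players V E \<Longrightarrow> D a = a"
      "\<And>x. x \<in> outer_matches \<Longrightarrow> D x \<in> paired \<phi>"
      "\<And>x. x \<in> outer_matches \<Longrightarrow> \<exists>y\<in>inN V E x. D y = D x \<and> (D x, y) \<in> E\<^sup>*"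
    by (metis DiffD1)
  have notS: "y \<notin> S" if "a \<in> outer_players" "(a, y) \<in> E\<^sup>*" for a y
    using that by (auto simp: subV_iff dest: rtrancl_trans)
  \<comment> \<open>The in-neighbour is above the outer player \<open>D x\<close>, hence outside
    \<open>S\<close>.\<close>
  have D_child: "\<exists>y\<in>inN V E x - S. D y = D x" if "x \<in> outer_matches" for x
    using D(3,4)[OF that] notS Zsub by blast
  have D_glue: "glue D R \<in> brackets V E" if "R \<in> brackets S F" for R
    using that D(1,2) D_child by (rule glue_bracket)
  have champion_glue: "glue (champion D a) R \<in> brackets V E"
    if R: "R \<in> brackets S F" and a: "a \<in> outer_players" for R a
  proof (rule glue_bracket[OF R])
    have aV: "a \<in> V" using a by (auto simp: players_def)
    show "champion D a v = undefined" if "v \<notin> V" for v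
      using that D(1) rtrancl_V_closed[of a v] aV by (auto simp: champion_def)
    show "champion D a b = b" if "b \<in> players V E" for b
      using that D(2) player_reached[of b a] by (auto simp: champion_def)
    show "\<exists>y\<in>inN V E x - S. champion D a y = champion D a x" if x: "x \<in> outer_matches" for x
    proof (cases "(a, x) \<in> E\<^sup>*")
      case True
      moreover have "a \<noteq> x" using a x by (auto simp: matches_def)
      ultimately obtain y where y: "(a, y) \<in> E\<^sup>*" "(y, x) \<in> E" by (metis rtranclE)
      then have "y \<in> inN V E x - S" using notS[OF a] E_subset by (auto simp: inN_def)
      then show ?thesis using y True by (auto simp: champion_def)
    next
      case False
      obtain y where y: "y \<in> inN V E x - S" "D y = D x" using D_child[OF x] by blast
      then have "(a, y) \<notin> E\<^sup>*"
        using False by (auto simp: inN_def dest: rtrancl_into_rtrancl)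
      then show ?thesis using y False by (auto simp: champion_def)
    qed
  qed
  have \<sigma>S: "scoring_system S F \<sigma>" using \<sigma> matches_sub by (auto simp: scoring_system_def)
  obtain R0 where R0: "finite R0" "card R0 = tdim S F \<sigma>" "resolving S F \<sigma> R0"
    using sub.ex_min_resolving[OF \<sigma>S] by blast
  obtain r where r: "r \<in> brackets S F" using sub.ex_bracket by blast
  \<comment> \<open>Some bracket must fill the inner part even when the dimension is zero. As
    \<open>I\<close> is nonempty, a singleton leaves the truncated difference unchanged.\<close>
  define R where "R = (if R0 = {} then {r} else R0)"
  have R: "finite R" "R \<noteq> {}" "resolving S F \<sigma> R" "R \<subseteq> brackets S F"
    using R0 r by (auto simp: R_def resolving_def)
  have Ine: "I \<noteq> {}" using i0 by blast
  have "card I \<noteq> 0" using finI Ine by simp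
  then have cardR: "card R - card I = tdim S F \<sigma> - card I"
    using R0 by (auto simp: R_def)
  obtain g where g: "g ` I \<subseteq> R" "card (R - g ` I) = card R - card I"
    using ex_map_small_deficit[OF finI Ine R(1,2)] by blast
  define C where "C = (\<lambda>a. glue (champion D a) (g (\<phi> a))) ` outer_players \<union> glue D ` (R - g ` I)"
  have gR: "g (\<phi> a) \<in> R" for a using g \<phi>I by blast
  have finC: "finite C" unfolding C_def using finite_players R(1) by auto
  have "card C \<le> card outer_players + card (R - g ` I)"
    unfolding C_def using finite_players R(1)
    by (intro order_trans[OF card_Un_le] add_mono card_image_le) auto
  also have "\<dots> = card outer_players + (tdim S F \<sigma> - card I)" using g cardR by simp
  finally have cardC: "card C \<le> card outer_players + (tdim S F \<sigma> - card I)" .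
  have "resolving V E \<sigma> C"
    unfolding resolving_def
  proof (intro conjI ballI impI)
    show "C \<subseteq> brackets V E"
      unfolding C_def using D_glue champion_glue gR R(4) by blast
    fix B B' assume B: "B \<in> brackets V E" "B' \<in> brackets V E" "B \<noteq> B'"
    show "\<exists>Bi\<in>C. score V E \<sigma> Bi B \<noteq> score V E \<sigma> Bi B'"
    proof (rule ccontr)
      assume "\<not> ?thesis"
      then have eqC: "score V E \<sigma> Bi B = score V E \<sigma> Bi B'" if "Bi \<in> C" for Bi
        using that by blast
      have eqa: "score S F \<sigma> (g (\<phi> a)) (inner B) + outer_score \<sigma> (champion D a) B =
          score S F \<sigma> (g (\<phi> a)) (inner B') + outer_score \<sigma> (champion D a) B'"
        if "a \<in> outer_players" for a
        using eqC[of "glue (champion D a) (g (\<phi> a))"] that unfolding score_glue C_def by blast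
      \<comment> \<open>The inner bracket of a champion depends only on its label, so the difference
        of inner scores can play the role of \<open>c\<close>.\<close>
      have outer: "B x = a \<longleftrightarrow> B' x = a" if "a \<in> outer_players" "x \<in> outer_matches" for a x
        using that
        by (intro outer_determined[where D = D and \<phi> = \<phi> and c =
              "\<lambda>i. score S F \<sigma> (g i) (inner B') - score S F \<sigma> (g i) (inner B)", OF \<sigma> B(1,2) D(3) cover])
          (use eqa in \<open>auto simp: algebra_simps\<close>)
      \<comment> \<open>With the outer wins known, outer scores cancel. A member hit by
        \<open>g\<close> is read off from a paired player, any other from its completion by
        \<open>D\<close>.\<close>
      have "score S F \<sigma> \<rho> (inner B) = score S F \<sigma> \<rho> (inner B')" if \<rho>: "\<rho> \<in> R" for \<rho>
      proof (cases "\<rho> \<in> g ` I")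
        case True
        then obtain a where a: "a \<in> paired \<phi>" "\<rho> = g (\<phi> a)" using pair by force
        then have aQ: "a \<in> outer_players" using Zsub by blast
        have "outer_score \<sigma> (champion D a) B = outer_score \<sigma> (champion D a) B'"
          by (intro outer_score_cong outer) (use aQ D(3) Zsub in \<open>auto simp: champion_def\<close>)
        then show ?thesis using eqa[OF aQ] a by simp
      next
        case False
        have "outer_score \<sigma> D B = outer_score \<sigma> D B'"
          by (intro outer_score_cong outer) (use D(3) Zsub in auto)
        moreover have "glue D \<rho> \<in> C" using \<rho> False by (auto simp: C_def)
        ultimately show ?thesis using eqC[of "glue D \<rho>"] unfolding score_glue by simp
      qed
      then have "inner B = inner B'"
        using R(3) inner_bracket B unfolding resolving_def by blast
      then show False using bracket_eqI[OF B(1,2)] outer B(3) by blast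
    qed
  qed
  then have "tdim V E \<sigma> \<le> card C" using tdim_le finC by blast
  then show ?thesis using cardC cardI by simp
qed

end

section \<open>The minimum over all admissible vertices\<close>

theorem theorem5p13:
  fixes V :: "'v set" and E :: "('v \<times> 'v) set" and \<sigma> :: "'v \<Rightarrow> real" and n :: nat
  assumes "se_tournament V E"
    and "n = card (players V E)"
    and "scoring_system V E \<sigma>"
  defines "U \<equiv> {u \<in> V. \<not> (\<exists>x\<in>outN V E u. \<exists>a\<in>players V E. inN V E x = {a, u})}"
  shows "int (tdim V E \<sigma>) \<le>
    Min ((\<lambda>u. int n - int (card (playersOf V E u))
       + max 0 (int (tdim (subV V E u) (subE V E u) \<sigma>)
           - int (\<Sum>x\<in>matches V E - matches (subV V E u) (subE V E u).
                 card (inN V E x \<inter> (players V E - playersOf V E u)) div 2))) ` U)"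
proof -
  interpret tournament V E by unfold_locales (rule assms(1))
  have finU: "finite U" using finite_V by (simp add: U_def)
  \<comment> \<open>The sink lies in \<open>U\<close>, having no out-neighbour, so the minimum is
    over a nonempty set.\<close>
  obtain s where "s \<in> V" "outN V E s = {}"
    using assms(1) unfolding se_tournament_def by blast
  then have Une: "U \<noteq> {}" by (auto simp: U_def)
  have bound: "int (tdim V E \<sigma>) \<le> int n - int (card (playersOf V E u))
       + max 0 (int (tdim (subV V E u) (subE V E u) \<sigma>)
           - int (\<Sum>x\<in>matches V E - matches (subV V E u) (subE V E u).
                 card (inN V E x \<inter> (players V E - playersOf V E u)) div 2))" if u: "u \<in> U" for u
  proof -
    interpret tournament_at V E u by unfold_locales (use u in \<open>simp add: U_def\<close>)
    have outer: "players V E - playersOf V E u = players V E - subV V E u"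
      unfolding playersOf_eq by blast
    have card: "int n - int (card (playersOf V E u)) = int (card (players V E - subV V E u))"
    proof -
      have "playersOf V E u \<subseteq> players V E" by (auto simp: playersOf_def)
      then show ?thesis
        using finite_players unfolding outer[symmetric] assms(2)
        by (simp add: card_Diff_subset finite_subset card_mono of_nat_diff)
    qed
    show ?thesis
    proof (cases "players V E - subV V E u = {}")
      case False
      have "tdim V E \<sigma> \<le> card (players V E - subV V E u) + (tdim (subV V E u) (subE V E u) \<sigma> -
          (\<Sum>x\<in>matches V E - subV V E u. card (inN V E x \<inter> (players V E - subV V E u)) div 2))"
        using u assms(3) False by (intro tdim_le_at) (auto simp: U_def)
      then show ?thesis unfolding card outer matches_outside by linarith
    next
      \<comment> \<open>With every player below \<open>u\<close>, the subtournament is the whole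
        tournament and the sum is empty.\<close>
      case True
      then have "playersOf V E v \<subseteq> playersOf V E u" for v
        unfolding playersOf_eq by (auto simp: playersOf_def)
      then have "subV V E u = V" by (auto simp: subV_def)
      moreover from this have "subE V E u = E" using E_subset by (auto simp: subE_def)
      moreover have "(\<Sum>x\<in>matches V E - V. h x) = 0" for h :: "'v \<Rightarrow> int"
        by (intro sum.neutral) (auto simp: matches_def)
      ultimately show ?thesis unfolding card outer matches_outside by simp
    qed
  qed
  show ?thesis using finU Une bound by (intro Min.boundedI) auto
qed

end
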